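(* Let $p,q$ be coprime positive integers. The sequence $\{S_m(p,q)\}_{m\ge0}$ is periodic of period $pq$, and over one full period its mean is given by $$\frac{1}{pq}\sum_{m=0}^{pq-1}S_m(p,q)=0.$$ In particular, the moments oscillate symmetrically around $0$. Moreover, the variance is given by $$\frac{1}{pq}\sum_{m=0}^{pq-1}|S_m(p,q)|^2=(p-1)(q-1).$$
   Context: For coprime positive integers $p,q$ and an integer $m$, the $m$-th moment is $S_m(p,q)=\sum_{\zeta\in\mathcal{Z}_{p,q}}\zeta^m$, where $\mathcal{Z}_{p,q}=\{\zeta\in\mathbb{C}:\zeta^{pq}=1,\ \zeta^p\ne1,\ \zeta^q\ne1\}$ is the set of zeros of the Alexander polynomial $\frac{(t^{pq}-1)(t-1)}{(t^p-1)(t^q-1)}$ of the torus knot $T_{p,q}$. "Periodic of period $pq$" means $S_{m+pq}(p,q)=S_m(p,q)$ for all $m$. *)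

theory Defs
  imports Complex_Main
begin

text \<open>The zeros of the Alexander polynomial
  (t^(pq) - 1) (t - 1) / ((t^p - 1) (t^q - 1)) of the torus knot T(p,q).\<close>

definition torus_zeros :: "nat \<Rightarrow> nat \<Rightarrow> complex set" where
  "torus_zeros p q = {\<zeta>. \<zeta> ^ (p * q) = 1 \<and> \<zeta> ^ p \<noteq> 1 \<and> \<zeta> ^ q \<noteq> 1}"

lemma finite_torus_zeros:
  assumes "p > 0" "q > 0"
  shows "finite (torus_zeros p q)"
proof (rule finite_subset)
  show "torus_zeros p q \<subseteq> {\<zeta>. \<zeta> ^ (p * q) = 1}"
    by (auto simp: torus_zeros_def)
  show "finite {\<zeta>::complex. \<zeta> ^ (p * q) = 1}"
    using assms by (intro finite_roots_unity) (simp add: Suc_le_eq)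
qed

definition moment :: "int \<Rightarrow> nat \<Rightarrow> nat \<Rightarrow> complex" where
  "moment m p q = (\<Sum>\<zeta>\<in>torus_zeros p q. \<zeta> powi m)"

end

theory Submission
  imports Defs
begin

text \<open>The moments \<open>S\<^sub>m\<close> are the discrete Fourier transform of the indicator function of the set of zeros,
  which is a set of \<open>pq\<close>-th roots of unity. The mean detects whether \<open>1\<close> is a zero, and by
  Parseval the variance is the number of zeros; coprimality makes \<open>1\<close> the only common
  \<open>p\<close>-th and \<open>q\<close>-th root of unity, so inclusion-exclusion counts \<open>pq - p - q + 1\<close> zeros.\<close>

lemma sum_powers_root_unity:
  fixes z :: "'a :: field"
  assumes "z ^ n = 1"
  shows "(\<Sum>m<n. z ^ m) = (if z = 1 then of_nat n else 0)"
  using assms by (simp add: geometric_sum)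

text \<open>Expanding the squared modulus gives a double sum over pairs from \<open>A\<close>. Once
  the sum over \<open>m\<close> is innermost, orthogonality kills every pair off the diagonal, and
  each of the \<open>card A\<close> diagonal pairs contributes \<open>n\<close>.\<close>

lemma parseval_roots_unity:
  fixes A :: "complex set"
  assumes "n > 0" and A: "A \<subseteq> {z. z ^ n = 1}"
  shows "(\<Sum>m<n. (cmod (\<Sum>z\<in>A. z ^ m))\<^sup>2) = real n * real (card A)"
proof -
  have "finite A"
    using finite_subset[OF A] finite_roots_unity[of n] \<open>n > 0\<close> by simp
  have orthogonality: "(\<Sum>m<n. (z * cnj w) ^ m) = (if w = z then of_nat n else 0)"
    if "z \<in> A" "w \<in> A" for z w
  proof -
    have zn: "z ^ n = 1" and wn: "w ^ n = 1"
      using that A by auto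
    \<comment> \<open>On the unit circle conjugation is inversion, so \<open>z * cnj w\<close> is
      the quotient z/w: an \<open>n\<close>-th root of unity that is 1 exactly on the
      diagonal.\<close>
    have "cmod w = 1"
      using wn \<open>n > 0\<close> by (metis norm_ge_zero norm_one norm_power power_eq_1_iff order_less_irrefl)
    then have ww: "w * cnj w = 1"
      by (simp add: complex_norm_square[symmetric])
    have "(z * cnj w = 1) = (w = z)"
      using ww by (metis mult.assoc mult.commute mult_1)
    moreover have "(z * cnj w) ^ n = 1"
      using zn wn by (simp add: power_mult_distrib flip: complex_cnj_power)
    ultimately show ?thesis
      by (simp add: sum_powers_root_unity)
  qed
  \<comment> \<open>The computation runs in the complex numbers, where the squared modulus factors
    as s times \<open>cnj s\<close>; injectivity of \<open>of_real\<close> brings the result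
    back.\<close>
  have "complex_of_real (\<Sum>m<n. (cmod (\<Sum>z\<in>A. z ^ m))\<^sup>2)
      = (\<Sum>m<n. \<Sum>z\<in>A. \<Sum>w\<in>A. (z * cnj w) ^ m)"
    by (simp only: of_real_sum complex_norm_square cnj_sum complex_cnj_power
        sum_product power_mult_distrib)
  also have "\<dots> = (\<Sum>z\<in>A. \<Sum>w\<in>A. \<Sum>m<n. (z * cnj w) ^ m)"
    by (subst sum.swap, rule sum.cong[OF refl], rule sum.swap)
  also have "\<dots> = (\<Sum>z\<in>A. \<Sum>w\<in>A. if w = z then of_nat n else 0)"
    by (simp add: orthogonality cong: sum.cong)
  also have "\<dots> = complex_of_real (real n * real (card A))"
    using \<open>finite A\<close> by simp
  finally show ?thesis
    by (simp only: of_real_eq_iff)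
qed

text \<open>By Bezout, 1 is a difference of a multiple of \<open>p\<close> and a multiple of
  \<open>q\<close>, and \<open>z\<close> to either multiple is 1. Writing this as an equation of
  sums keeps all exponents natural.\<close>

lemma coprime_roots_unity_eq_1:
  fixes z :: "'a :: field"
  assumes "p > 0" "coprime p q" "z ^ p = 1" "z ^ q = 1"
  shows "z = 1"
proof -
  obtain x y where "p * x = q * y + 1"
    using bezout_nat[of p q] assms by auto
  then have "z ^ (p * x) = z ^ (q * y) * z"
    by simp
  then show ?thesis
    using assms by (simp add: power_mult)
qed

lemma card_torus_zeros:
  assumes "p > 0" "q > 0" "coprime p q"
  shows "real (card (torus_zeros p q)) = (real p - 1) * (real q - 1)"
proof -
  define R where "R n = {z::complex. z ^ n = 1}" for n
  have fin: "finite (R n)" and card: "card (R n) = n" if "n > 0" for n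
    using that finite_roots_unity[of n] card_roots_unity_eq[of n] by (auto simp: R_def)
  have "R p \<inter> R q = {1}"
    using coprime_roots_unity_eq_1[OF assms(1,3)] by (auto simp: R_def)
  \<comment> \<open>The summand 1 counts the intersection; additive forms avoid truncated
    subtraction until the count moves to the reals.\<close>
  then have Un: "card (R p \<union> R q) + 1 = p + q"
    using card_Un_Int[of "R p" "R q"] fin card assms by simp
  have sub: "R p \<union> R q \<subseteq> R (p * q)"
    unfolding R_def
  proof (intro Un_least subsetI; clarify)
    fix z :: complex
    show "z ^ (p * q) = 1" if "z ^ p = 1"
      using that by (simp add: power_mult)
    show "z ^ (p * q) = 1" if "z ^ q = 1"
      using that by (simp add: power_mult mult.commute[of p])
  qed
  have "torus_zeros p q = R (p * q) - (R p \<union> R q)"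
    by (auto simp: torus_zeros_def R_def)
  then have "card (torus_zeros p q) + card (R p \<union> R q) = p * q"
    using card_Diff_subset[OF _ sub] card_mono[OF _ sub] fin card assms by simp
  then have "real (card (torus_zeros p q)) + real (card (R p \<union> R q)) = real p * real q"
    by (metis of_nat_add of_nat_mult)
  moreover have "real (card (R p \<union> R q)) + 1 = real p + real q"
    using Un by (metis of_nat_add of_nat_1)
  ultimately show ?thesis
    by (simp add: algebra_simps)
qed

theorem proposition3p10:
  fixes p q :: nat
  assumes "p > 0" and "q > 0" and "coprime p q"
  shows "(\<forall>m::int. moment (m + int (p * q)) p q = moment m p q) \<and>
    1 / of_nat (p * q) * (\<Sum>m = 0..<p * q. moment (int m) p q) = 0 \<and>
    1 / real (p * q) * (\<Sum>m = 0..<p * q. (cmod (moment (int m) p q))\<^sup>2)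
      = (real p - 1) * (real q - 1)"
proof (intro conjI allI)
  have pq: "p * q > 0"
    using assms by simp
  have root: "z ^ (p * q) = 1" and neq1: "z \<noteq> 1" if "z \<in> torus_zeros p q" for z
    using that by (auto simp: torus_zeros_def)
  have moment_nat: "moment (int m) p q = (\<Sum>z\<in>torus_zeros p q. z ^ m)" for m
    by (simp add: moment_def)
  show "moment (m + int (p * q)) p q = moment m p q" for m
    unfolding moment_def
  proof (rule sum.cong[OF refl])
    fix z assume z: "z \<in> torus_zeros p q"
    \<comment> \<open>The exponent \<open>m\<close> may be negative, so splitting the power calls
      for a nonzero base. Keeping \<open>int (p * q)\<close> unexpanded lets the second factor
      become the natural power that \<open>root\<close> evaluates.\<close>
    then have "z \<noteq> 0"
      using root[OF z] pq by (auto simp: power_0_left)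
    then show "z powi (m + int (p * q)) = z powi m"
      using root[OF z] by (simp add: power_int_add del: of_nat_mult)
  qed
  have "(\<Sum>m = 0..<p * q. moment (int m) p q) = (\<Sum>z\<in>torus_zeros p q. \<Sum>m<p * q. z ^ m)"
    unfolding moment_nat atLeast0LessThan by (rule sum.swap)
  \<comment> \<open>Each inner sum runs over all powers of a root of unity other than 1, so it
    vanishes.\<close>
  also have "\<dots> = 0"
    using root neq1 by (simp add: sum_powers_root_unity)
  finally show "1 / of_nat (p * q) * (\<Sum>m = 0..<p * q. moment (int m) p q) = 0"
    by simp
  have "(\<Sum>m = 0..<p * q. (cmod (moment (int m) p q))\<^sup>2)
      = real (p * q) * real (card (torus_zeros p q))"
    unfolding moment_nat atLeast0LessThan
    using pq root by (intro parseval_roots_unity) auto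
  then show "1 / real (p * q) * (\<Sum>m = 0..<p * q. (cmod (moment (int m) p q))\<^sup>2)
      = (real p - 1) * (real q - 1)"
    using pq card_torus_zeros[OF assms] by simp
qed

end
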